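(* For all positive integers $u,v$, $\Phi(u\times v,4,2)\le J^*(u\times v)$.
   Context: A 2-D $(u\times v,4,2)$-OOC is a family $\mathcal C$ of $u\times v$ $(0,1)$-matrices of Hamming weight $4$ such that for all $A=(a_{ij}),B=(b_{ij})\in\mathcal C$ and integers $r$ with $A\ne B$ or $r\not\equiv0\pmod v$, $\sum_{i,j}a_{ij}b_{i,j+r}\le 2$ (column indices mod $v$). $\Phi(u\times v,4,2)$ is the largest size of such a code. Write $N=\lfloor\frac{uv-1}{3}\lfloor\frac{uv-2}{2}\rfloor\rfloor$. Let $A=\{(u,v):u\equiv0\ (\mathrm{mod}\ 12),\ v\equiv2,4\ (\mathrm{mod}\ 6)\}$ and $B=\{(u,v):uv\equiv0\ (\mathrm{mod}\ 12),\ v\equiv0\ (\mathrm{mod}\ 6)\}$. Define $J^*(u\times v)$ as: $\lfloor\frac{u}{4}N\rfloor-1$ if $u\equiv7,11\pmod{12}$ and $v=2$; $\lfloor\frac{u}{4}(N-1)\rfloor$ if either ($uv\equiv0\pmod 6$ and $(u,v)\notin A\cup B$) or ($uv\equiv4,8\pmod{12}$ and $v$ even); $\lfloor\frac{u}{4}(N-1)\rfloor-1$ if $(u,v)\in A$; $\lfloor\frac{u}{4}(N-2)\rfloor$ if $(u,v)\in B$; and $\lfloor\frac{u}{4}N\rfloor$ otherwise. *)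

theory Defs
  imports Complex_Main
begin

text \<open>A u x v (0,1)-matrix is represented by its support: the set of cells (i,j)
  with a_ij = 1, where 0 <= i < u and 0 <= j < v. Its Hamming weight is the
  cardinality of the support.\<close>

definition is_matrix :: "nat \<Rightarrow> nat \<Rightarrow> (nat \<times> nat) set \<Rightarrow> bool" where
  "is_matrix u v A \<longleftrightarrow> A \<subseteq> {0..<u} \<times> {0..<v}"

definition corr :: "nat \<Rightarrow> (nat \<times> nat) set \<Rightarrow> (nat \<times> nat) set \<Rightarrow> int \<Rightarrow> nat" where
  "corr v A B r = card {(i,j) \<in> A. (i, nat ((int j + r) mod int v)) \<in> B}"

definition is_OOC :: "nat \<Rightarrow> nat \<Rightarrow> (nat \<times> nat) set set \<Rightarrow> bool" where
  "is_OOC u v C \<longleftrightarrow>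
     (\<forall>A\<in>C. is_matrix u v A \<and> card A = 4) \<and>
     (\<forall>A\<in>C. \<forall>B\<in>C. \<forall>r::int. (A \<noteq> B \<or> r mod int v \<noteq> 0) \<longrightarrow> corr v A B r \<le> 2)"

definition Phi :: "nat \<Rightarrow> nat \<Rightarrow> nat" where
  "Phi u v = Max {card C | C. is_OOC u v C}"

definition Nval :: "nat \<Rightarrow> nat \<Rightarrow> int" where
  "Nval u v = \<lfloor>(real (u*v) - 1) / 3 * real_of_int \<lfloor>(real (u*v) - 2) / 2\<rfloor>\<rfloor>"

definition inA :: "nat \<Rightarrow> nat \<Rightarrow> bool" where
  "inA u v \<longleftrightarrow> u mod 12 = 0 \<and> (v mod 6 = 2 \<or> v mod 6 = 4)"

definition inB :: "nat \<Rightarrow> nat \<Rightarrow> bool" where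
  "inB u v \<longleftrightarrow> (u*v) mod 12 = 0 \<and> v mod 6 = 0"

definition Jstar :: "nat \<Rightarrow> nat \<Rightarrow> int" where
  "Jstar u v =
    (let N = Nval u v; q = real u / 4 in
     if (u mod 12 = 7 \<or> u mod 12 = 11) \<and> v = 2 then \<lfloor>q * real_of_int N\<rfloor> - 1
     else if inA u v then \<lfloor>q * real_of_int (N - 1)\<rfloor> - 1
     else if inB u v then \<lfloor>q * real_of_int (N - 2)\<rfloor>
     else if ((u*v) mod 6 = 0 \<and> \<not> inA u v \<and> \<not> inB u v) \<or>
             (((u*v) mod 12 = 4 \<or> (u*v) mod 12 = 8) \<and> even v)
       then \<lfloor>q * real_of_int (N - 1)\<rfloor>
     else \<lfloor>q * real_of_int N\<rfloor>)"

end

theory Submission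
  imports Defs
begin

text \<open>The cyclic translates of the codewords are 4-subsets of the \<open>n = u v\<close> cells, no triple of
  cells lies in two of them, and no translate is fixed by a nontrivial shift. Counting incidences,
  \<open>4 |C| \<le> u D\<close> whenever every cell lies on at most \<open>D\<close> translates. For a cell \<open>x\<close>
  consider the graph of pairs \<open>{y, z}\<close> such that \<open>{x, y, z}\<close> is uncovered. For even \<open>n\<close>
  all its degrees are even, and its number of edges is determined modulo 3, so few uncovered triples
  are possible only in very rigid configurations. The shift by \<open>v / 2\<close> acts without fixed points on
  the translates containing \<open>x\<close> and its image, so their number is even, and \<open>x\<close> together
  with its shifts by \<open>v / 3\<close> and \<open>2 v / 3\<close> is uncovered. These two facts exclude the rigid
  configurations.\<close>

section \<open>Parity and residue preliminaries\<close>

text \<open>Removing one orbit \<open>{x, f x}\<close> leaves a smaller set on which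
  \<open>f\<close> is still a fixed-point-free involution.\<close>

lemma even_card_involution:
  assumes "finite S" and "\<And>x. x \<in> S \<Longrightarrow> f x \<in> S" and "\<And>x. x \<in> S \<Longrightarrow> f (f x) = x"
    and "\<And>x. x \<in> S \<Longrightarrow> f x \<noteq> x"
  shows "even (card S)"
  using assms
proof (induction "card S" arbitrary: S rule: less_induct)
  case less
  show ?case
  proof (cases "S = {}")
    case False
    then obtain x where x: "x \<in> S" by blast
    let ?T = "S - {x, f x}"
    have two: "card {x, f x} = 2" using less.prems(4)[OF x] by auto
    have sub: "{x, f x} \<subseteq> S" using x less.prems(2) by auto
    have c: "card S = card ?T + 2"
      using card_Diff_subset[OF _ sub] two card_mono[OF less.prems(1) sub] by auto
    have "even (card ?T)"
    proof (rule less.hyps)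
      show "f y \<in> ?T" if "y \<in> ?T" for y
        using that x less.prems(2,3) by (metis Diff_iff insert_iff singletonD)
    qed (use c less.prems in auto)
    then show ?thesis using c by simp
  qed simp
qed

text \<open>Fixes the residue of every defect modulo 6. With \<open>n = 2 * (k + 1)\<close> the
  product is \<open>2 * (2 * k + 1) * k\<close>, so only \<open>k mod 3\<close> matters.\<close>

lemma prod_mod_6:
  fixes n :: nat
  assumes "n > 0" "even n"
  shows "(n - 1) * (n - 2) mod 6 = (if n mod 6 = 0 then 2 else 0)"
proof -
  obtain k where k: "n = 2 * Suc k"
    using assms by (metis dvdE mult_0_right gr0_implies_Suc not_gr_zero)
  have "(n - 1) * (n - 2) = 2 * ((2 * k + 1) * k)" by (simp add: k)
  then have "(n - 1) * (n - 2) mod 6 = 2 * (((2 * k + 1) * k) mod 3)"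
    by (simp add: mult_mod_right)
  also have "((2 * k + 1) * k) mod 3 = ((2 * (k mod 3) + 1) * (k mod 3)) mod 3"
    by (intro mod_mult_cong mod_add_cong) (simp_all add: mod_mult_right_eq)
  finally have *: "(n - 1) * (n - 2) mod 6 = 2 * (((2 * (k mod 3) + 1) * (k mod 3)) mod 3)" .
  have n6: "n mod 6 = 0 \<longleftrightarrow> k mod 3 = 2" unfolding k by presburger
  consider "k mod 3 = 0" | "k mod 3 = 1" | "k mod 3 = 2" by linarith
  then show ?thesis using * n6 by cases simp_all
qed

section \<open>Packings of 4-subsets under a cyclic action\<close>

text \<open>The cyclic group of order \<open>v\<close> acts freely on points
  (\<open>act_fix\<close>) and on blocks (\<open>act_block_fix\<close>); the second property
  reflects the autocorrelation condition and drives the parity arguments.\<close>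

locale cyclic_packing =
  fixes X :: "'a set" and \<B> :: "'a set set" and act :: "int \<Rightarrow> 'a \<Rightarrow> 'a" and v :: nat
  assumes finite_X: "finite X"
    and block: "B \<in> \<B> \<Longrightarrow> B \<subseteq> X" "B \<in> \<B> \<Longrightarrow> card B = 4"
    and packing: "B \<in> \<B> \<Longrightarrow> B' \<in> \<B> \<Longrightarrow> B \<noteq> B' \<Longrightarrow> card (B \<inter> B') \<le> 2"
    and act_closed: "x \<in> X \<Longrightarrow> act r x \<in> X"
    and act_add: "x \<in> X \<Longrightarrow> act r (act s x) = act (r + s) x"
    and act_fix: "x \<in> X \<Longrightarrow> act r x = x \<longleftrightarrow> int v dvd r"
    and act_block: "B \<in> \<B> \<Longrightarrow> act r ` B \<in> \<B>"
    and act_block_fix: "B \<in> \<B> \<Longrightarrow> act r ` B = B \<Longrightarrow> int v dvd r"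
begin

definition unc :: "'a \<Rightarrow> 'a \<Rightarrow> 'a \<Rightarrow> bool" where
  "unc x y z \<longleftrightarrow> {x, y, z} \<subseteq> X \<and> distinct [x, y, z] \<and> \<not> (\<exists>B\<in>\<B>. {x, y, z} \<subseteq> B)"

definition unc_nbrs :: "'a \<Rightarrow> 'a \<Rightarrow> 'a set" where
  "unc_nbrs x y = {z. unc x y z}"

definition deg :: "'a \<Rightarrow> nat" where
  "deg x = card {B \<in> \<B>. x \<in> B}"

definition codeg :: "'a \<Rightarrow> 'a \<Rightarrow> nat" where
  "codeg x y = card {B \<in> \<B>. x \<in> B \<and> y \<in> B}"

text \<open>The leave graph at \<open>x\<close> joins \<open>y\<close> and \<open>z\<close> iff \<open>unc x y z\<close>; \<open>defect x\<close> is twice its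
  number of edges and \<open>leave x\<close> is the set of its non-isolated vertices.\<close>

definition defect :: "'a \<Rightarrow> nat" where
  "defect x = (\<Sum>y\<in>X - {x}. card (unc_nbrs x y))"

definition leave :: "'a \<Rightarrow> 'a set" where
  "leave x = {y. \<exists>z. unc x y z}"

lemma finite_blocks: "finite \<B>"
  by (rule finite_subset[of _ "Pow X"]) (use finite_X block(1) in auto)

lemma finite_block: "B \<in> \<B> \<Longrightarrow> finite B"
  using block(1) finite_X finite_subset by blast

lemma block_eqI:
  assumes "B \<in> \<B>" "B' \<in> \<B>" "{x, y, z} \<subseteq> B" "{x, y, z} \<subseteq> B'" "distinct [x, y, z]"
  shows "B = B'"
proof (rule ccontr)
  assume "B \<noteq> B'"
  then have "card (B \<inter> B') \<le> 2" using assms packing by blast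
  moreover have "card {x, y, z} \<le> card (B \<inter> B')"
    using assms finite_block by (intro card_mono) auto
  moreover have "card {x, y, z} = 3" using assms(5) by simp
  ultimately show False by simp
qed

lemma unc_commute: "unc x y z \<longleftrightarrow> unc y x z" "unc x y z \<longleftrightarrow> unc x z y"
  by (auto simp: unc_def)

lemma unc_D: "unc x y z \<Longrightarrow> x \<in> X \<and> y \<in> X \<and> z \<in> X \<and> x \<noteq> y \<and> x \<noteq> z \<and> y \<noteq> z"
  by (auto simp: unc_def)

lemma finite_unc_nbrs: "finite (unc_nbrs x y)"
  by (rule finite_subset[OF _ finite_X]) (auto simp: unc_nbrs_def dest: unc_D)

lemma leave_subset: "leave x \<subseteq> X - {x}"
  by (auto simp: leave_def dest: unc_D)

lemma finite_leave: "finite (leave x)"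
  using leave_subset finite_X finite_subset by blast

lemma leaveI: "unc x y z \<Longrightarrow> y \<in> leave x" "unc x y z \<Longrightarrow> z \<in> leave x"
  using unc_commute by (auto simp: leave_def)

section \<open>Counting degrees, codegrees and defects\<close>

text \<open>The blocks through \<open>x\<close> and \<open>y\<close>, with these two points removed,
  are disjoint pairs; together with the uncovered neighbours they partition
  \<open>X - {x, y}\<close>. Hence leave degrees have the parity of \<open>card X\<close>.\<close>

lemma card_unc_nbrs:
  assumes "x \<in> X" "y \<in> X" "x \<noteq> y"
  shows "card (unc_nbrs x y) + 2 * codeg x y = card X - 2"
proof -
  let ?P = "{B \<in> \<B>. x \<in> B \<and> y \<in> B}"
  have eq: "X - {x, y} = unc_nbrs x y \<union> (\<Union>B\<in>?P. B - {x, y})"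
    using assms block(1) by (auto simp: unc_nbrs_def unc_def)
  have disj: "unc_nbrs x y \<inter> (\<Union>B\<in>?P. B - {x, y}) = {}"
    by (auto simp: unc_nbrs_def unc_def)
  have "card (\<Union>B\<in>?P. B - {x, y}) = (\<Sum>B\<in>?P. card (B - {x, y}))"
  proof (rule card_UN_disjoint)
    show "\<forall>B\<in>?P. \<forall>B'\<in>?P. B \<noteq> B' \<longrightarrow> (B - {x, y}) \<inter> (B' - {x, y}) = {}"
    proof (intro ballI impI, rule ccontr)
      fix B B' assume *: "B \<in> ?P" "B' \<in> ?P" "B \<noteq> B'" "(B - {x, y}) \<inter> (B' - {x, y}) \<noteq> {}"
      then obtain z where "z \<in> B" "z \<in> B'" "z \<noteq> x" "z \<noteq> y" by auto
      then show False using block_eqI[of B B' x y z] * assms(3) by auto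
    qed
  qed (use finite_blocks finite_block in auto)
  also have "\<dots> = (\<Sum>B\<in>?P. 2)"
  proof (rule sum.cong)
    fix B assume "B \<in> ?P"
    then show "card (B - {x, y}) = 2"
      using block(2) assms(3) by (subst card_Diff_subset) auto
  qed simp
  also have "\<dots> = 2 * codeg x y" by (simp add: codeg_def)
  finally have "card (\<Union>B\<in>?P. B - {x, y}) = 2 * codeg x y" .
  moreover have "card (X - {x, y}) = card (unc_nbrs x y) + card (\<Union>B\<in>?P. B - {x, y})"
    unfolding eq using disj finite_unc_nbrs finite_blocks finite_block
    by (intro card_Un_disjoint) auto
  moreover have "card (X - {x, y}) = card X - 2"
    using assms by (subst card_Diff_subset) auto
  ultimately show ?thesis by simp
qed

lemma sum_codeg:
  assumes "x \<in> X"
  shows "(\<Sum>y\<in>X - {x}. codeg x y) = 3 * deg x"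
proof -
  have "(\<Sum>y\<in>X - {x}. card {B \<in> {B \<in> \<B>. x \<in> B}. y \<in> B}) = sum (\<lambda>_. 3) {B \<in> \<B>. x \<in> B}"
  proof (rule sum_multicount_gen)
    show "\<forall>B\<in>{B \<in> \<B>. x \<in> B}. card {y \<in> X - {x}. y \<in> B} = 3"
    proof
      fix B assume B: "B \<in> {B \<in> \<B>. x \<in> B}"
      then have "{y \<in> X - {x}. y \<in> B} = B - {x}" using block(1) by auto
      then show "card {y \<in> X - {x}. y \<in> B} = 3" using B block(2) by simp
    qed
  qed (use finite_X finite_blocks in auto)
  then show ?thesis by (simp add: codeg_def deg_def)
qed

lemma sum_deg: "(\<Sum>x\<in>X. deg x) = 4 * card \<B>"
proof -
  have "(\<Sum>x\<in>X. card {B \<in> \<B>. x \<in> B}) = sum (\<lambda>_. 4) \<B>"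
  proof (rule sum_multicount_gen)
    show "\<forall>B\<in>\<B>. card {x \<in> X. x \<in> B} = 4"
    proof
      fix B assume B: "B \<in> \<B>"
      then have "{x \<in> X. x \<in> B} = B" using block(1) by auto
      then show "card {x \<in> X. x \<in> B} = 4" using B block(2) by simp
    qed
  qed (use finite_X finite_blocks in auto)
  then show ?thesis by (simp add: deg_def)
qed

text \<open>Sum \<open>card_unc_nbrs\<close> over \<open>y\<close>; each block through
  \<open>x\<close> is counted by three codegrees. Upper bounds on \<open>deg\<close> thus amount to
  lower bounds on \<open>defect\<close>.\<close>

lemma defect_deg:
  assumes "x \<in> X"
  shows "defect x + 6 * deg x = (card X - 1) * (card X - 2)"
proof -
  have "defect x + 6 * deg x = (\<Sum>y\<in>X - {x}. card (unc_nbrs x y) + 2 * codeg x y)"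
    using sum_codeg[OF assms] by (simp add: defect_def sum.distrib flip: sum_distrib_left)
  also have "\<dots> = (\<Sum>y\<in>X - {x}. card X - 2)"
    using assms by (intro sum.cong) (auto intro!: card_unc_nbrs)
  also have "\<dots> = (card X - 1) * (card X - 2)"
    using assms finite_X by simp
  finally show ?thesis .
qed

text \<open>The Johnson bound before the division by 3: each codegree is at most half of
  \<open>card X - 2\<close>, rounded down. It also serves odd \<open>card X\<close>.\<close>

lemma deg_le:
  assumes "x \<in> X"
  shows "3 * deg x \<le> (card X - 1) * ((card X - 2) div 2)"
proof -
  have "(\<Sum>y\<in>X - {x}. codeg x y) \<le> (\<Sum>y\<in>X - {x}. (card X - 2) div 2)"
  proof (rule sum_mono)
    fix y assume "y \<in> X - {x}"
    then show "codeg x y \<le> (card X - 2) div 2" using card_unc_nbrs[of x y] assms by auto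
  qed
  then show ?thesis using sum_codeg[OF assms] assms finite_X by simp
qed

lemma defect_leave: "defect x = (\<Sum>y\<in>leave x. card (unc_nbrs x y))"
  unfolding defect_def
proof (rule sum.mono_neutral_right)
  show "\<forall>y\<in>X - {x} - leave x. card (unc_nbrs x y) = 0"
    by (auto simp: leave_def unc_nbrs_def)
qed (use finite_X leave_subset in auto)

text \<open>The degree of \<open>y\<close> in the leave graph is even and nonzero.\<close>

lemma card_unc_nbrs_ge:
  assumes "even (card X)" "unc x y z"
  shows "2 \<le> card (unc_nbrs x y)"
proof -
  have "even (card (unc_nbrs x y))"
    using card_unc_nbrs[of x y] unc_D[OF assms(2)] assms(1)
    by (metis dvd_add_left_iff dvd_diff_nat dvd_triv_left dvd_refl)
  moreover have "card (unc_nbrs x y) \<noteq> 0"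
    using assms(2) finite_unc_nbrs by (auto simp: unc_nbrs_def)
  ultimately show ?thesis by presburger
qed

lemma leave_nbrs_ge:
  assumes "even (card X)" "y \<in> leave x"
  shows "2 \<le> card (unc_nbrs x y)"
  using assms card_unc_nbrs_ge by (auto simp: leave_def)

lemma defect_ge:
  assumes "even (card X)"
  shows "2 * card (leave x) \<le> defect x"
proof -
  have "(\<Sum>y\<in>leave x. 2) \<le> (\<Sum>y\<in>leave x. card (unc_nbrs x y))"
    by (intro sum_mono leave_nbrs_ge assms)
  then show ?thesis by (simp add: defect_leave)
qed

text \<open>Count \<open>y\<close> and its neighbours, of which there are at least two.\<close>

lemma card_leave_ge:
  assumes "even (card X)" "unc x y z"
  shows "3 \<le> card (leave x)"
proof -
  have "insert y (unc_nbrs x y) \<subseteq> leave x"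
    using assms(2) leaveI by (auto simp: unc_nbrs_def)
  then have "card (insert y (unc_nbrs x y)) \<le> card (leave x)"
    using finite_leave card_mono by blast
  moreover have "y \<notin> unc_nbrs x y" by (auto simp: unc_nbrs_def dest: unc_D)
  ultimately show ?thesis
    using card_unc_nbrs_ge[OF assms] finite_unc_nbrs by simp
qed

lemma unc_exists:
  assumes "defect x > 0"
  obtains y z where "unc x y z"
proof -
  have "leave x \<noteq> {}" using assms by (auto simp: defect_leave)
  then show thesis using that by (auto simp: leave_def)
qed

lemma defect_ge_6:
  assumes "even (card X)" "defect x > 0"
  shows "6 \<le> defect x"
proof -
  obtain y z where "unc x y z" using unc_exists assms(2) by blast
  then have "3 \<le> card (leave x)" using card_leave_ge assms(1) by blast
  then show ?thesis using defect_ge[OF assms(1), of x] by simp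
qed

section \<open>Uncovered triples and the cyclic action\<close>

lemma act_0: "x \<in> X \<Longrightarrow> act 0 x = x"
  using act_fix by simp

lemma act_uminus: "x \<in> X \<Longrightarrow> act (- r) (act r x) = x" "x \<in> X \<Longrightarrow> act r (act (- r) x) = x"
  using act_add act_0 by auto

lemma act_eq_iff:
  assumes "x \<in> X"
  shows "act r x = act s x \<longleftrightarrow> int v dvd r - s"
proof -
  have "act r x = act s x \<longleftrightarrow> act (- s) (act r x) = act (- s) (act s x)"
    using assms act_uminus(2) act_closed by metis
  also have "\<dots> \<longleftrightarrow> act (r - s) x = x"
    using assms act_add act_0 by simp
  finally show ?thesis using act_fix assms by simp
qed

lemma act_inj: "x \<in> X \<Longrightarrow> y \<in> X \<Longrightarrow> act r x = act r y \<longleftrightarrow> x = y"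
  by (metis act_uminus(1))

text \<open>A block covering the shifted triple would shift back to a block covering the original
  one.\<close>

lemma unc_act:
  assumes "unc x y z"
  shows "unc (act r x) (act r y) (act r z)"
  unfolding unc_def
proof (intro conjI notI)
  note D = unc_D[OF assms]
  show "{act r x, act r y, act r z} \<subseteq> X" using D act_closed by auto
  show "distinct [act r x, act r y, act r z]" using D act_inj by auto
  assume "\<exists>B\<in>\<B>. {act r x, act r y, act r z} \<subseteq> B"
  then obtain B where B: "B \<in> \<B>" "{act r x, act r y, act r z} \<subseteq> B" by blast
  then have "act (- r) ` {act r x, act r y, act r z} \<subseteq> act (- r) ` B" by blast
  then have "{x, y, z} \<subseteq> act (- r) ` B" using D act_uminus by simp
  then show False using act_block[OF B(1)] assms by (auto simp: unc_def)
qed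

text \<open>The shift by \<open>h\<close> swaps \<open>x\<close> with its image, so it permutes the
  blocks through both. It is an involution there, without fixed blocks because \<open>v\<close> does
  not divide \<open>h\<close>.\<close>

lemma even_codeg_half:
  assumes "v = 2 * h" "h > 0" "x \<in> X"
  shows "even (codeg x (act (int h) x))"
  unfolding codeg_def
proof (rule even_card_involution[where f = "\<lambda>B. act (int h) ` B"])
  have hh: "act (int h) (act (int h) x) = x"
    using assms act_add act_fix by simp
  fix B assume "B \<in> {B \<in> \<B>. x \<in> B \<and> act (int h) x \<in> B}"
  then have B: "B \<in> \<B>" "x \<in> B" "act (int h) x \<in> B" by auto
  show "act (int h) ` B \<in> {B \<in> \<B>. x \<in> B \<and> act (int h) x \<in> B}"
    using B act_block hh by (auto intro: rev_image_eqI)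
  have "act (int h) ` act (int h) ` B = (\<lambda>y. y) ` B"
    unfolding image_image using block(1)[OF B(1)] assms(1) act_add act_fix
    by (intro image_cong) auto
  then show "act (int h) ` act (int h) ` B = B" by simp
  show "act (int h) ` B \<noteq> B"
    using act_block_fix[OF B(1), of "int h"] assms by (auto dest: zdvd_imp_le)
qed (use finite_blocks in simp)

text \<open>Twice the codegree is divisible by 4 while \<open>card X - 2\<close> is 2 modulo 4, so
  the leave degree of the image of \<open>x\<close> cannot vanish.\<close>

lemma unc_half:
  assumes "v = 2 * h" "h > 0" "x \<in> X" "4 dvd card X"
  obtains y where "unc x (act (int h) x) y"
proof -
  have "act (int h) x \<noteq> x" using assms act_fix by (auto dest: zdvd_imp_le)
  then have "card (unc_nbrs x (act (int h) x)) + 2 * codeg x (act (int h) x) = card X - 2"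
    using card_unc_nbrs assms(3) act_closed by metis
  moreover have "4 dvd 2 * codeg x (act (int h) x)"
    using even_codeg_half[OF assms(1-3)] by auto
  \<comment> \<open>Rules out the truncated value \<open>0 - 2 = 0\<close>.\<close>
  moreover have "card X > 0" using assms(3) finite_X card_gt_0_iff by blast
  ultimately have "card (unc_nbrs x (act (int h) x)) \<noteq> 0"
    using assms(4) by presburger
  then have "unc_nbrs x (act (int h) x) \<noteq> {}" by auto
  then show thesis using that by (auto simp: unc_nbrs_def)
qed

section \<open>Lower bounds on the defect\<close>

lemma defect_mod_6:
  assumes "x \<in> X"
  shows "defect x mod 6 = (card X - 1) * (card X - 2) mod 6"
  unfolding defect_deg[OF assms, symmetric] by simp

text \<open>The defect is 2 modulo 6, hence positive, hence at least 6; the next value with this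
  residue is 8.\<close>

lemma defect_ge_8:
  assumes "x \<in> X" "card X mod 6 = 0"
  shows "8 \<le> defect x"
proof -
  have ev: "even (card X)" using assms(2) by presburger
  have "card X > 0" using assms(1) finite_X card_gt_0_iff by blast
  then have m: "defect x mod 6 = 2" using prod_mod_6 ev defect_mod_6 assms by simp
  then have "6 \<le> defect x" using defect_ge_6[OF ev, of x] by presburger
  then show ?thesis using m by presburger
qed

text \<open>Five leave vertices of degree at least 2 give defect at least 10; the next value that is
  2 modulo 6 is 14.\<close>

lemma defect_ge_14:
  assumes "x \<in> X" "card X mod 6 = 0" "5 \<le> card (leave x)"
  shows "14 \<le> defect x"
proof -
  have ev: "even (card X)" using assms(2) by presburger
  have "card X > 0" using assms(1) finite_X card_gt_0_iff by blast
  then have "defect x mod 6 = 2" using prod_mod_6 ev defect_mod_6 assms by simp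
  then show ?thesis using defect_ge[OF ev, of x] assms(3) by presburger
qed

text \<open>Serves the case where 6 does not divide \<open>card X\<close>: there the residue modulo
  6 is 0 and does not exclude defect 0, but the triple from \<open>unc_half\<close> does.\<close>

lemma defect_ge_6_half:
  assumes "v = 2 * h" "h > 0" "x \<in> X" "4 dvd card X"
  shows "6 \<le> defect x"
proof -
  have ev: "even (card X)" using assms(4) by auto
  obtain y where "unc x (act (int h) x) y" using unc_half assms by blast
  then have "3 \<le> card (leave x)" using card_leave_ge ev by blast
  then show ?thesis using defect_ge[OF ev, of x] by simp
qed

lemma card_leave_sixth:
  assumes v: "v = 6 * w" "w > 0" and x: "x \<in> X" and n: "card X mod 12 = 0"
  shows "5 \<le> card (leave x)"
proof -
  \<comment> \<open>The \<open>g k\<close> are the six shifts of \<open>x\<close> by multiples of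
    \<open>v / 6\<close>, indexed modulo 6.\<close>
  define g where "g k = act (k * int w) x" for k :: int
  have ev: "even (card X)" using n by presburger
  have gX: "g k \<in> X" for k using x act_closed by (simp add: g_def)
  have g_eq: "g k = g l \<longleftrightarrow> 6 dvd k - l" for k l
  proof -
    have "g k = g l \<longleftrightarrow> int w * 6 dvd int w * (k - l)"
      unfolding g_def using act_eq_iff[OF x] v by (simp add: algebra_simps)
    also have "\<dots> \<longleftrightarrow> 6 dvd k - l" using v(2) by simp
    finally show ?thesis .
  qed
  have g_act: "act (k * int w) (g l) = g (k + l)" for k l
    unfolding g_def using x act_add by (simp add: distrib_right)
  have g0: "g 0 = x" using x act_0 by (simp add: g_def)
  \<comment> \<open>The shift by \<open>v / 3\<close> permutes these three points, so a block
    containing them would be fixed by it.\<close>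
  have u024: "unc x (g 2) (g 4)"
    unfolding unc_def
  proof (intro conjI notI)
    show "distinct [x, g 2, g 4]" using g_eq by (auto simp flip: g0)
    show "{x, g 2, g 4} \<subseteq> X" using x gX by simp
    assume "\<exists>B\<in>\<B>. {x, g 2, g 4} \<subseteq> B"
    then obtain B where B: "B \<in> \<B>" "{g 0, g 2, g 4} \<subseteq> B" using g0 by auto
    have "act (2 * int w) ` {g 0, g 2, g 4} \<subseteq> act (2 * int w) ` B" using B by blast
    moreover have "act (2 * int w) ` {g 0, g 2, g 4} = {g 0, g 2, g 4}"
      using g_eq[of 6 0] by (auto simp: g_act)
    moreover have "distinct [g 0, g 2, g 4]" using g_eq by simp
    ultimately have "act (2 * int w) ` B = B"
      using block_eqI[of "act (2 * int w) ` B" B "g 0" "g 2" "g 4"] B act_block by metis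
    then have "int v dvd 2 * int w" using act_block_fix B by blast
    then show False using v by (auto dest: zdvd_imp_le)
  qed
  obtain y where y: "unc x (g 3) y"
  proof (rule unc_half[of "3 * w" x])
    show "4 dvd card X" using n by presburger
    fix y assume "unc x (act (int (3 * w)) x) y"
    then show thesis using that by (simp add: g_def)
  qed (use v x in auto)
  have five: "5 \<le> card (leave x)" if "distinct [a, b, c, d, e]" "{a, b, c, d, e} \<subseteq> leave x"
    for a b c d e
    using card_mono[OF finite_leave that(2)] that(1) by simp
  \<comment> \<open>Shifting back by \<open>a * w\<close> carries \<open>g a\<close> to
    \<open>x\<close>, \<open>x\<close> to \<open>g (- a)\<close> and \<open>g b\<close> to
    \<open>g (b - a)\<close>.\<close>
  have shift: "g (- a) \<in> leave x" "g (b - a) \<in> leave x" if "unc x (g a) (g b)" for a b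
  proof -
    have "unc (act (- a * int w) (g 0)) (act (- a * int w) (g a)) (act (- a * int w) (g b))"
      using unc_act that g0 by metis
    then have "unc (g (- a)) x (g (b - a))" by (simp only: g_act) (simp add: g0)
    then have "unc x (g (- a)) (g (b - a))" using unc_commute by metis
    then show "g (- a) \<in> leave x" "g (b - a) \<in> leave x" using leaveI by blast+
  qed
  \<comment> \<open>The shift by \<open>v / 2\<close> swaps \<open>x\<close> and
    \<open>g 3\<close>.\<close>
  have y3: "unc x (g 3) (act (3 * int w) y)"
  proof -
    have "unc (act (3 * int w) x) (act (3 * int w) (g 3)) (act (3 * int w) y)"
      using unc_act y by blast
    moreover have "act (3 * int w) x = g 3" "act (3 * int w) (g 3) = x"
      using g_act[of 3 3] g_eq[of 6 0] g0 by (auto simp: g_def)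
    ultimately show ?thesis using unc_commute by metis
  qed
  note in_leave = leaveI[OF u024] leaveI[OF y] leaveI[OF y3]
  have g5: "g (- 1) = g 5" using g_eq[of "-1" 5] by simp
  show ?thesis
  \<comment> \<open>The leave contains \<open>g 2\<close>, \<open>g 3\<close>, \<open>g 4\<close>.
    If one of these two triples is uncovered, its shifts add \<open>g 1\<close> and
    \<open>g 5\<close>; otherwise \<open>y\<close> and its half shift are two further
    points.\<close>
  proof (cases "unc x (g 3) (g 2) \<or> unc x (g 3) (g 4)")
    case True
    then have "g 1 \<in> leave x \<and> g 5 \<in> leave x"
    proof
      assume "unc x (g 3) (g 2)"
      then show ?thesis using shift[of 2 3] shift[of 3 2] unc_commute(2) g5 by auto
    next
      assume "unc x (g 3) (g 4)"
      then show ?thesis using shift[of 4 3] shift[of 3 4] unc_commute(2) g5 by auto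
    qed
    moreover have "distinct [g 1, g 2, g 3, g 4, g 5]" using g_eq by simp
    ultimately show ?thesis using five in_leave by blast
  next
    case False
    have "act (3 * int w) y \<noteq> y"
      using act_fix[of y "3 * int w"] unc_D[OF y] v by (auto dest: zdvd_imp_le)
    then have "distinct [g 2, g 3, g 4, y, act (3 * int w) y]"
      using g_eq False y y3 unc_D[OF y] unc_D[OF y3] by auto
    then show ?thesis using five in_leave by blast
  qed
qed

text \<open>If \<open>defect = 8\<close> at every point, all leave graphs are 4-cycles. At \<open>y\<close> with \<open>{x, \<sigma> x, y}\<close>
  uncovered, where \<open>\<sigma>\<close> is the shift by \<open>v / 2\<close>, the neighbourhood of \<open>\<sigma> y\<close> is \<open>\<sigma>\<close>-invariant,
  so it must be \<open>{x, \<sigma> x}\<close>, which creates a triangle.\<close>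

lemma exists_defect_gt_8:
  assumes v: "v = 2 * h" "h > 0" and n: "card X mod 12 = 0" and ne: "X \<noteq> {}"
  shows "\<exists>x\<in>X. 8 < defect x"
proof -
  define \<sigma> where "\<sigma> = act (int h)"
  have ev: "even (card X)" "4 dvd card X" and "card X mod 6 = 0" using n by presburger+
  have \<sigma>X: "\<sigma> x \<in> X" "\<sigma> (\<sigma> x) = x" "\<sigma> x \<noteq> x" if "x \<in> X" for x
    using that act_closed act_add act_fix v by (auto simp: \<sigma>_def dest: zdvd_imp_le)
  obtain x where x: "x \<in> X" using ne by blast
  obtain y where y: "unc x (\<sigma> x) y" using unc_half[OF v x ev(2)] by (auto simp: \<sigma>_def)
  note yD = unc_D[OF y]
  obtain a where a: "unc y (\<sigma> y) a"
    using unc_half[of h y] v yD ev(2) by (auto simp: \<sigma>_def)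
  note aD = unc_D[OF a]
  have "unc (\<sigma> y) (\<sigma> (\<sigma> y)) (\<sigma> a)" using unc_act[OF a] by (simp add: \<sigma>_def)
  then have \<sigma>a: "unc y (\<sigma> y) (\<sigma> a)" using \<sigma>X yD unc_commute by metis
  have y': "unc y x (\<sigma> x)" using y unc_commute by metis
  show ?thesis
  proof (cases "a = x \<or> a = \<sigma> x")
    \<comment> \<open>Then the leave at \<open>y\<close> has five vertices, which forces defect at
      least 10.\<close>
    case False
    have "\<sigma> a \<noteq> x" "\<sigma> a \<noteq> \<sigma> x" "\<sigma> y \<noteq> x" "\<sigma> y \<noteq> \<sigma> x" "\<sigma> y \<noteq> \<sigma> a"
      using False \<sigma>X(2) yD aD by metis+
    then have "distinct [x, \<sigma> x, \<sigma> y, a, \<sigma> a]"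
      using False yD aD \<sigma>X(3)[of a] by auto
    moreover have "{x, \<sigma> x, \<sigma> y, a, \<sigma> a} \<subseteq> leave y"
      using leaveI[OF y'] leaveI[OF a] leaveI[OF \<sigma>a] by auto
    ultimately have "5 \<le> card (leave y)"
      using card_mono[OF finite_leave, of "{x, \<sigma> x, \<sigma> y, a, \<sigma> a}" y] by simp
    then have "8 < defect y" using defect_ge[OF ev(1), of y] by simp
    then show ?thesis using yD by blast
  next
    \<comment> \<open>Now \<open>x\<close>, \<open>\<sigma> x\<close>, \<open>\<sigma> y\<close>
      form a triangle in the leave at \<open>y\<close>, and no graph with four edges and all
      non-isolated degrees at least 2 contains a triangle.\<close>
    case True
    let ?T = "{x, \<sigma> x, \<sigma> y}"
    have sx: "unc y (\<sigma> y) x" "unc y (\<sigma> y) (\<sigma> x)"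
      using True a \<sigma>a \<sigma>X(2) x by metis+
    have dT: "distinct [x, \<sigma> x, \<sigma> y]"
      using unc_D[OF sx(1)] unc_D[OF sx(2)] yD by auto
    then have cT: "card ?T = 3" by simp
    have tri: "unc y p q" if "p \<in> ?T" "q \<in> ?T" "p \<noteq> q" for p q
    proof -
      note sym = unc_commute(2)[THEN iffD1]
      show ?thesis using that y' sx sym[OF y'] sym[OF sx(1)] sym[OF sx(2)] by blast
    qed
    have TL: "?T \<subseteq> leave y" using leaveI[OF y'] leaveI[OF sx(1)] by auto
    show ?thesis
    proof (rule ccontr)
      assume "\<not> ?thesis"
      then have d8: "defect y \<le> 8" "8 \<le> defect y"
        using yD defect_ge_8[of y] \<open>card X mod 6 = 0\<close> by (auto simp: not_less)
      show False
      proof (cases "leave y = ?T")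
        \<comment> \<open>A triangle alone gives defect at most 6.\<close>
        case True
        have "card (unc_nbrs y p) \<le> 2" if "p \<in> ?T" for p
        proof -
          have "unc_nbrs y p \<subseteq> ?T - {p}"
            using True leaveI(2) unc_D by (fastforce simp: unc_nbrs_def)
          then have "card (unc_nbrs y p) \<le> card (?T - {p})" by (intro card_mono) auto
          also have "\<dots> = 2" using that cT by (subst card_Diff_singleton) auto
          finally show ?thesis .
        qed
        then have "defect y \<le> (\<Sum>p\<in>?T. 2)"
          unfolding defect_leave True by (rule sum_mono)
        then show False using d8 cT by simp
      next
        case False
        then obtain w where w: "w \<in> leave y" "w \<notin> ?T" using TL by blast
        then obtain p where p: "unc y w p" by (auto simp: leave_def)
        have pL: "p \<in> leave y" using leaveI p by blast
        have "card (insert w ?T) \<le> card (leave y)"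
          using TL w by (intro card_mono finite_leave) auto
        then have c4: "4 \<le> card (leave y)" using w(2) cT by simp
        show False
        proof (cases "p \<in> ?T")
          \<comment> \<open>Here \<open>p\<close> has degree at least 3 and at least three other
            vertices have degree at least 2, so the defect is at least 9.\<close>
          case True
          have "insert w (?T - {p}) \<subseteq> unc_nbrs y p"
            using tri[OF True] p unc_commute(2) by (auto simp: unc_nbrs_def)
          then have "card (insert w (?T - {p})) \<le> card (unc_nbrs y p)"
            by (intro card_mono finite_unc_nbrs)
          moreover have "card (insert w (?T - {p})) = 3"
            using w(2) True cT by (subst card_insert_disjoint) auto
          moreover have "(\<Sum>q\<in>leave y - {p}. 2) \<le> (\<Sum>q\<in>leave y - {p}. card (unc_nbrs y q))"
            using leave_nbrs_ge[OF ev(1)] by (intro sum_mono) auto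
          moreover have "defect y = card (unc_nbrs y p) + (\<Sum>q\<in>leave y - {p}. card (unc_nbrs y q))"
            unfolding defect_leave using pL finite_leave by (rule sum.remove[rotated])
          ultimately show False using d8 c4 pL finite_leave by simp
        next
          case False
          have "card (insert p (insert w ?T)) \<le> card (leave y)"
            using TL w pL by (intro card_mono finite_leave) auto
          moreover have "card (insert p (insert w ?T)) = 5"
            using w(2) cT False unc_D[OF p] by (subst card_insert_disjoint) auto
          ultimately have "5 \<le> card (leave y)" by simp
          then show False using d8 defect_ge[OF ev(1), of y] by simp
        qed
      qed
    qed
  qed
qed

text \<open>Here the defects are divisible by 6, so only four points lie on uncovered triples, and
  the leave at each of them is a triangle on the other three. This makes \<open>codeg x (act 1 x)\<close> odd.\<close>

lemma sum_defect_ne_24: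
  assumes v: "v = 2" and n: "card X mod 4 = 2" "card X mod 6 \<noteq> 0"
  shows "(\<Sum>x\<in>X. defect x) \<noteq> 24"
proof
  assume sum24: "(\<Sum>x\<in>X. defect x) = 24"
  have ev: "even (card X)" using n by presburger
  define S where "S = {x \<in> X. defect x > 0}"
  have finS: "finite S" using finite_X by (simp add: S_def)
  have d6: "6 \<le> defect x" if "x \<in> S" for x using that defect_ge_6[OF ev] by (simp add: S_def)
  have sumS: "(\<Sum>x\<in>S. defect x) = 24"
    using sum24 finite_X by (subst sum.mono_neutral_left[of X]) (auto simp: S_def)
  then obtain x where x: "x \<in> S" by fastforce
  have xX: "x \<in> X" using x by (simp add: S_def)
  \<comment> \<open>Uncoveredness is symmetric, so each point of an uncovered triple has a nonempty
    leave and positive defect.\<close>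
  have inS: "p \<in> S \<and> q \<in> S \<and> r \<in> S" if "unc p q r" for p q r
  proof -
    have "defect a > 0" if "unc a b c" for a b c
      using card_leave_ge[OF ev that] defect_ge[OF ev, of a] by simp
    then show ?thesis using that unc_D[OF that] unc_commute unfolding S_def by blast
  qed
  obtain y z where yz: "unc x y z" using x unc_exists by (auto simp: S_def)
  let ?x' = "act (int 1) x"
  have x'S: "?x' \<in> S" using inS[OF unc_act[OF yz]] by blast
  have x': "?x' \<noteq> x" using act_fix[OF xX, of 1] v by simp
  have LS: "leave x \<subseteq> S - {x}" using inS leave_subset unfolding leave_def by blast
  have L3: "3 \<le> card (leave x)" using card_leave_ge[OF ev yz] .
  \<comment> \<open>Four points of defect at least 6 already use up the total 24, so all these
    estimates are equalities.\<close>
  have "(\<Sum>x\<in>S - {x}. 6) \<le> (\<Sum>x\<in>S - {x}. defect x)" using d6 by (intro sum_mono) auto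
  moreover have "24 = defect x + (\<Sum>x\<in>S - {x}. defect x)"
    unfolding sumS[symmetric] using finS x by (rule sum.remove)
  ultimately have *: "defect x + 6 * card (S - {x}) \<le> 24" by simp
  have "3 \<le> card (S - {x})" using L3 LS finS card_mono[of "S - {x}" "leave x"] by simp
  then have dx: "defect x = 6" and c3: "card (S - {x}) = 3"
    using * d6[OF x] by linarith+
  have L: "leave x = S - {x}"
    using LS L3 c3 finS by (intro card_subset_eq) (auto intro: le_antisym dest: card_mono[rotated])
  then have x'L: "?x' \<in> leave x" using x'S x' by simp
  \<comment> \<open>Three leave vertices of degree at least 2 share the defect 6, so the degree of
    \<open>?x'\<close> is exactly 2.\<close>
  have "(\<Sum>q\<in>leave x - {?x'}. 2) \<le> (\<Sum>q\<in>leave x - {?x'}. card (unc_nbrs x q))"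
    using leave_nbrs_ge[OF ev] by (intro sum_mono) auto
  moreover have "defect x = card (unc_nbrs x ?x') + (\<Sum>q\<in>leave x - {?x'}. card (unc_nbrs x q))"
    unfolding defect_leave using finite_leave x'L by (rule sum.remove)
  moreover have "card (leave x - {?x'}) = 2" using x'L c3 L by simp
  ultimately have "card (unc_nbrs x ?x') = 2" using dx leave_nbrs_ge[OF ev x'L] by simp
  then have "2 + 2 * codeg x ?x' = card X - 2"
    using card_unc_nbrs[OF xX act_closed[OF xX, of "int 1"]] x' by metis
  moreover have "even (codeg x ?x')" using even_codeg_half[of 1 x] v xX by simp
  then have "4 dvd 2 * codeg x ?x'" by auto
  ultimately show False using n by presburger
qed

end

section \<open>Codes as cyclic packings of the cells\<close>

text \<open>Uses the column expression of \<open>corr\<close>, so that a correlation becomes the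
  size of an intersection with a translate.\<close>

definition shift :: "nat \<Rightarrow> int \<Rightarrow> nat \<times> nat \<Rightarrow> nat \<times> nat" where
  "shift v r p = (fst p, nat ((int (snd p) + r) mod int v))"

definition translates :: "nat \<Rightarrow> (nat \<times> nat) set set \<Rightarrow> (nat \<times> nat) set set" where
  "translates v C = {shift v r ` A | A r. A \<in> C}"

context
  fixes u v :: nat
  assumes v_pos: "v > 0"
begin

lemma shift_closed: "p \<in> {0..<u} \<times> {0..<v} \<Longrightarrow> shift v r p \<in> {0..<u} \<times> {0..<v}"
  using v_pos by (auto simp: shift_def nat_less_iff)

lemma shift_add: "shift v r (shift v s p) = shift v (r + s) p"
  using v_pos by (simp add: shift_def mod_simps ac_simps)

lemma shift_fix:
  assumes "p \<in> {0..<u} \<times> {0..<v}"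
  shows "shift v r p = p \<longleftrightarrow> int v dvd r"
proof -
  obtain i j where p: "p = (i, j)" "j < v" using assms by auto
  have "shift v r p = p \<longleftrightarrow> (int j + r) mod int v = int j mod int v"
    using v_pos p by (simp add: shift_def nat_eq_iff)
  also have "\<dots> \<longleftrightarrow> int v dvd r" by (simp add: mod_eq_dvd_iff)
  finally show ?thesis .
qed

lemma inj_on_shift: "inj_on (shift v r) ({0..<u} \<times> {0..<v})"
proof (rule inj_on_inverseI)
  fix p assume "p \<in> {0..<u} \<times> {0..<v}"
  then show "shift v (- r) (shift v r p) = p" using shift_add shift_fix by simp
qed

lemma corr_eq_card:
  assumes "A \<subseteq> {0..<u} \<times> {0..<v}"
  shows "corr v A B r = card (shift v r ` A \<inter> B)"
proof -
  have "shift v r ` A \<inter> B = shift v r ` {(i, j) \<in> A. (i, nat ((int j + r) mod int v)) \<in> B}"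
    by (auto simp: shift_def image_iff)
  moreover have "inj_on (shift v r) {(i, j) \<in> A. (i, nat ((int j + r) mod int v)) \<in> B}"
    using assms by (intro inj_on_subset[OF inj_on_shift]) auto
  ultimately show ?thesis by (simp add: corr_def card_image)
qed

context
  fixes C :: "(nat \<times> nat) set set"
  assumes ooc: "is_OOC u v C"
begin

lemma codeword: "A \<in> C \<Longrightarrow> A \<subseteq> {0..<u} \<times> {0..<v}" "A \<in> C \<Longrightarrow> card A = 4"
  using ooc by (auto simp: is_OOC_def is_matrix_def)

lemma card_shift_codeword: "A \<in> C \<Longrightarrow> card (shift v r ` A) = 4"
  using card_image[OF inj_on_subset[OF inj_on_shift codeword(1)]] codeword(2) by simp

text \<open>Up to a common shift by \<open>s\<close>, the intersection is the one counted by the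
  correlation at offset \<open>r - s\<close>.\<close>

lemma card_inter_translates:
  assumes A: "A \<in> C" and B: "B \<in> C" and ne: "A \<noteq> B \<or> \<not> int v dvd r - s"
  shows "card (shift v r ` A \<inter> shift v s ` B) \<le> 2"
proof -
  have "shift v s ` (shift v (r - s) ` A \<inter> B) = shift v r ` A \<inter> shift v s ` B"
  proof (subst inj_on_image_Int[OF inj_on_shift])
    show "shift v (r - s) ` A \<subseteq> {0..<u} \<times> {0..<v}" using codeword(1)[OF A] shift_closed by blast
    show "B \<subseteq> {0..<u} \<times> {0..<v}" using codeword(1)[OF B] .
  qed (simp add: image_image shift_add)
  then have "card (shift v r ` A \<inter> shift v s ` B) \<le> card (shift v (r - s) ` A \<inter> B)"
    using codeword(2)[OF B] by (metis card_image_le card.infinite finite_Int zero_neq_numeral)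
  also have "\<dots> = corr v A B (r - s)" using corr_eq_card codeword(1)[OF A] by simp
  also have "\<dots> \<le> 2"
    using ooc A B ne unfolding is_OOC_def by (metis dvd_eq_mod_eq_0)
  finally show ?thesis .
qed

text \<open>Equal translates would meet in 4 cells, against the bound 2. So orbits of codewords have
  full length \<open>v\<close> and are disjoint.\<close>

lemma translate_eqD:
  assumes "A \<in> C" "B \<in> C" "shift v r ` A = shift v s ` B"
  shows "A = B \<and> int v dvd r - s"
  using card_inter_translates[OF assms(1,2), of r s] card_shift_codeword[OF assms(2), of s] assms(3)
  by auto

text \<open>The correlation bounds make distinct translates meet in at most two cells, and
  \<open>translate_eqD\<close> gives trivial stabilizers.\<close>

lemma cyclic_packing_translates:
  "cyclic_packing ({0..<u} \<times> {0..<v}) (translates v C) (shift v) v"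
proof
  fix B assume "B \<in> translates v C"
  then obtain A r where B: "A \<in> C" "B = shift v r ` A" by (auto simp: translates_def)
  show "B \<subseteq> {0..<u} \<times> {0..<v}" using B codeword(1) shift_closed by blast
  show "card B = 4" using B card_shift_codeword by simp
  show "shift v s ` B \<in> translates v C" for s
    using B by (auto simp: translates_def image_image shift_add)
  show "int v dvd s" if "shift v s ` B = B" for s
    using that B translate_eqD[of A A "s + r" r] by (simp add: image_image shift_add)
  fix B' assume "B' \<in> translates v C" "B \<noteq> B'"
  then obtain A' r' where B': "A' \<in> C" "B' = shift v r' ` A'" by (auto simp: translates_def)
  have "A \<noteq> A' \<or> \<not> int v dvd r - r'"
  proof (rule ccontr)
    assume "\<not> ?thesis"
    then have "A = A'" "int v dvd r - r'" by auto
    moreover have "shift v r p = shift v r' p" if "p \<in> A" for p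
    proof -
      have "shift v (r - r') p = p" using shift_fix codeword(1) B(1) that calculation(2) by blast
      then show ?thesis by (metis shift_add add.commute diff_add_cancel)
    qed
    ultimately show False using \<open>B \<noteq> B'\<close> B B' by (metis image_cong)
  qed
  then show "card (B \<inter> B') \<le> 2" using card_inter_translates B B' by blast
next
  show "shift v r (shift v s p) = shift v (r + s) p" for r s p by (rule shift_add)
qed (use shift_closed shift_fix in auto)

lemma card_translates: "card (translates v C) = v * card C"
proof -
  let ?f = "\<lambda>(A, r). shift v (int r) ` A"
  have "inj_on ?f (C \<times> {0..<v})"
  proof (rule inj_onI, clarsimp)
    fix A r B s assume *: "A \<in> C" "B \<in> C" "r < v" "s < v" "shift v (int r) ` A = shift v (int s) ` B"
    then have "A = B" "int v dvd int r - int s" using translate_eqD by blast+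
    then show "A = B \<and> r = s" using *(3,4) by (metis mod_eq_dvd_iff mod_less of_nat_eq_iff of_nat_mod)
  qed
  then have "card (?f ` (C \<times> {0..<v})) = v * card C"
    by (simp add: card_image card_cartesian_product)
  moreover have "?f ` (C \<times> {0..<v}) = translates v C"
  proof (intro equalityI subsetI)
    fix B assume "B \<in> translates v C"
    then obtain A r where B: "A \<in> C" "B = shift v r ` A" by (auto simp: translates_def)
    have "shift v r = shift v (int (nat (r mod int v)))"
      using v_pos by (simp add: shift_def fun_eq_iff mod_simps)
    moreover have "nat (r mod int v) < v" using v_pos by (simp add: nat_less_iff)
    ultimately show "B \<in> ?f ` (C \<times> {0..<v})"
      using B by (intro rev_image_eqI[of "(A, nat (r mod int v))"]) auto
  qed (auto simp: translates_def)
  ultimately show ?thesis by simp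
qed

end
end

section \<open>Integer form of the floors\<close>

lemma Nval_eq:
  "Nval u v = ((int (u * v) - 1) * ((int (u * v) - 2) div 2)) div 3"
proof -
  define n where "n = int (u * v)"
  have "\<lfloor>(real_of_int n - 2) / 2\<rfloor> = (n - 2) div 2"
    using floor_divide_of_int_eq[of "n - 2" 2, where ?'a = real] by simp
  moreover have "\<lfloor>(real_of_int n - 1) / 3 * real_of_int ((n - 2) div 2)\<rfloor>
      = ((n - 1) * ((n - 2) div 2)) div 3"
    using floor_divide_of_int_eq[of "(n - 1) * ((n - 2) div 2)" 3, where ?'a = real] by simp
  moreover have "real (u * v) = real_of_int n" by (simp add: n_def)
  ultimately show ?thesis unfolding Nval_def n_def[symmetric] by presburger
qed

text \<open>For even \<open>u * v\<close> the inner floor is exact, and the outer one discards just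
  the residue modulo 6 given by \<open>prod_mod_6\<close>.\<close>

lemma six_Nval:
  assumes "u * v > 0" "even (u * v)"
  shows "6 * Nval u v + (if (u * v) mod 6 = 0 then 2 else 0) = int ((u * v - 1) * (u * v - 2))"
proof -
  define n where "n = u * v"
  have n: "n > 0" "even n" using assms by (auto simp: n_def)
  then have n2: "n \<ge> 2" by presburger
  define P where "P = (n - 1) * (n - 2)"
  have "int n - 2 = 2 * ((int n - 2) div 2)" using n(2) by simp
  moreover have "int P = (int n - 1) * (int n - 2)" using n2 by (simp add: P_def of_nat_diff)
  ultimately have P: "int P = 2 * ((int n - 1) * ((int n - 2) div 2))"
    by (metis mult.left_commute)
  have "P mod 6 = (if n mod 6 = 0 then 2 else 0)"
    unfolding P_def using prod_mod_6 n by blast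
  then have P6: "int P mod 6 = (if n mod 6 = 0 then 2 else 0)"
    using zmod_int[of P 6] by (auto split: if_splits)
  have "6 * (M div 3) + k = int P" if "int P = 2 * M" "int P mod 6 = k" for M k
    using that by presburger
  from this[OF P P6] show ?thesis
    unfolding Nval_eq n_def[symmetric] P_def[symmetric] .
qed

lemma floor_quarter: "\<lfloor>real u / 4 * real_of_int D\<rfloor> = (int u * D) div 4"
  using floor_divide_of_int_eq[of "int u * D" 4, where ?'a = real] by simp

section \<open>The bound, case by case\<close>

lemma card_OOC_le_Jstar:
  assumes u: "u > 0" and v: "v > 0" and ooc: "is_OOC u v C"
  shows "int (card C) \<le> Jstar u v"
proof -
  let ?X = "{0..<u} \<times> {0..<v}"
  interpret cyclic_packing ?X "translates v C" "shift v" v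
    using cyclic_packing_translates v ooc .
  define n where "n = u * v"
  define N where "N = Nval u v"
  define c where "c = int (card C)"
  have cX: "card ?X = n" by (simp add: n_def)
  have n0: "n > 0" using u v by (simp add: n_def)
  have Xne: "?X \<noteq> {}" using u v by auto
  have total: "(\<Sum>x\<in>?X. int (deg x)) = 4 * int v * c"
    using sum_deg card_translates[OF v ooc] by (simp add: c_def flip: of_nat_sum)
  \<comment> \<open>The factor \<open>v\<close> cancels: there are \<open>u * v\<close> cells and
    \<open>v * c\<close> translates of four cells each.\<close>
  have bound: "c \<le> (int u * D) div 4" if "\<And>x. x \<in> ?X \<Longrightarrow> int (deg x) \<le> D" for D
  proof -
    have "4 * int v * c \<le> (\<Sum>x\<in>?X. D)" unfolding total[symmetric] using that by (intro sum_mono)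
    then have "int v * (4 * c) \<le> int v * (int u * D)" by (simp add: algebra_simps)
    then have "4 * c \<le> int u * D" using v by simp
    then show ?thesis by linarith
  qed
  \<comment> \<open>So \<open>deg x\<close> is \<open>N\<close> minus a sixth of the defect, or of
    the defect less 2 when 6 divides \<open>n\<close>. In the latter case defects 8 and 14 cost 1
    and 2; otherwise defect 6 costs 1.\<close>
  have deg6: "6 * int (deg x) = 6 * N + (if n mod 6 = 0 then 2 else 0) - int (defect x)"
    if "x \<in> ?X" "even n" for x
  proof -
    have "6 * N + (if n mod 6 = 0 then 2 else 0) = int ((n - 1) * (n - 2))"
      using six_Nval[of u v] that(2) n0 by (simp only: N_def n_def)
    also have "\<dots> = int (defect x + 6 * deg x)" using defect_deg[OF that(1)] cX by simp
    finally show ?thesis by simp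
  qed
  \<comment> \<open>The cases follow the tests in \<open>Jstar\<close>, with its fourth branch split
    into \<open>six\<close> and \<open>four\<close>.\<close>
  consider (special) "u mod 12 = 7 \<or> u mod 12 = 11" "v = 2"
    | (A) "inA u v" "\<not> ((u mod 12 = 7 \<or> u mod 12 = 11) \<and> v = 2)"
    | (B) "inB u v" "\<not> inA u v" "\<not> ((u mod 12 = 7 \<or> u mod 12 = 11) \<and> v = 2)"
    | (six) "n mod 6 = 0" "\<not> inB u v" "\<not> inA u v" "\<not> ((u mod 12 = 7 \<or> u mod 12 = 11) \<and> v = 2)"
    | (four) "n mod 12 = 4 \<or> n mod 12 = 8" "even v" "\<not> n mod 6 = 0" "\<not> inB u v" "\<not> inA u v"
        "\<not> ((u mod 12 = 7 \<or> u mod 12 = 11) \<and> v = 2)"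
    | (other) "\<not> n mod 6 = 0" "\<not> ((n mod 12 = 4 \<or> n mod 12 = 8) \<and> even v)" "\<not> inB u v" "\<not> inA u v"
        "\<not> ((u mod 12 = 7 \<or> u mod 12 = 11) \<and> v = 2)"
    by blast
  then show ?thesis
  proof cases
    case special
    have n: "n = 2 * u" using special by (simp add: n_def)
    have m: "n mod 4 = 2" "n mod 6 \<noteq> 0" "even n" using special(1) unfolding n by presburger+
    have N3: "3 * N = (2 * int u - 1) * (int u - 1)"
    proof -
      have "6 * N = int ((n - 1) * (n - 2))"
        using six_Nval[of u v] n0 m unfolding N_def n_def by simp
      also have "\<dots> = 2 * ((2 * int u - 1) * (int u - 1))"
      proof -
        have "int (n - 1) = 2 * int u - 1" "int (n - 2) = 2 * (int u - 1)" using u n by auto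
        then show ?thesis by simp
      qed
      finally show ?thesis by simp
    qed
    define k where "k = int (u div 12)"
    have "int u = 12 * k + 7 \<or> int u = 12 * k + 11"
      using special(1) unfolding k_def by presburger
    \<comment> \<open>The goal is \<open>u * N\<close> congruent to 2 modulo 4, so that the floor of
      \<open>u * N / 4\<close> is attained only if \<open>4 * c = u * N - 2\<close>.\<close>
    then have "\<exists>t. odd t \<and> N = 2 * t"
    proof
      assume k: "int u = 12 * k + 7"
      have "3 * N = 3 * (2 * ((24 * k + 13) * (2 * k + 1)))"
        unfolding N3 k by (simp add: algebra_simps)
      then have "N = 2 * ((24 * k + 13) * (2 * k + 1))" by simp
      then show ?thesis by (intro exI[of _ "(24 * k + 13) * (2 * k + 1)"]) simp
    next
      assume k: "int u = 12 * k + 11"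
      have "3 * N = 3 * (2 * ((8 * k + 7) * (6 * k + 5)))"
        unfolding N3 k by (simp add: algebra_simps)
      then have "N = 2 * ((8 * k + 7) * (6 * k + 5))" by simp
      then show ?thesis by (intro exI[of _ "(8 * k + 7) * (6 * k + 5)"]) simp
    qed
    then obtain t where t: "odd t" "N = 2 * t" by blast
    have "odd u" using special(1) by presburger
    then have "odd (int u * t)" using t(1) by simp
    moreover have "int u * N = 2 * (int u * t)" using t(2) by simp
    moreover have "Q mod 4 = 2" if "odd s" "Q = 2 * s" for Q s :: int using that by presburger
    ultimately have uN: "(int u * N) mod 4 = 2" by blast
    have "int (deg x) \<le> N" if "x \<in> ?X" for x using deg6[OF that m(3)] m(2) by simp
    then have "c \<le> (int u * N) div 4" by (rule bound)
    moreover have "4 * c \<noteq> int u * N - 2"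
    proof
      assume eq: "4 * c = int u * N - 2"
      \<comment> \<open>With \<open>v = 2\<close> the total defect is
        \<open>12 * (u * N - 4 * c)\<close>, which is the excluded value 24.\<close>
      have "int (\<Sum>x\<in>?X. defect x) = (\<Sum>x\<in>?X. 6 * N - 6 * int (deg x))"
        unfolding of_nat_sum using deg6 m(2,3) by (intro sum.cong) auto
      also have "\<dots> = int n * (6 * N) - 6 * (4 * int v * c)"
        unfolding total[symmetric] sum_distrib_left by (simp add: sum_subtractf n_def)
      also have "\<dots> = 12 * (int u * N) - 12 * (4 * c)" using special(2) by (simp add: n)
      also have "\<dots> = 24" using eq by simp
      finally have "(\<Sum>x\<in>?X. defect x) = 24" by linarith
      then show False using sum_defect_ne_24 special(2) m cX by metis
    qed
    moreover have "c \<le> Q div 4 - 1" if "c \<le> Q div 4" "4 * c \<noteq> Q - 2" "Q mod 4 = 2" for Q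
      using that by presburger
    ultimately have "c \<le> (int u * N) div 4 - 1" using uN by blast
    moreover have "Jstar u v = (int u * N) div 4 - 1"
      using special unfolding Jstar_def Let_def floor_quarter N_def by simp
    ultimately show ?thesis by (simp add: c_def)
  next
    case A
    have n: "n mod 12 = 0" using A(1) by (auto simp: inA_def n_def mod_eq_0_iff_dvd)
    obtain h where h: "v = 2 * h" "h > 0" 
    proof -
      have "even v" using A(1) unfolding inA_def by presburger
      then show thesis using that v by auto
    qed
    have m: "n mod 6 = 0" "even n" using n by presburger+
    obtain w where w: "w \<in> ?X" "8 < defect w" using exists_defect_gt_8[OF h] n Xne cX by metis
    have le: "int (deg x) \<le> N - 1" if "x \<in> ?X" for x
      using deg6[OF that m(2)] m(1) defect_ge_8[OF that] cX by simp
    have lt: "int (deg w) < N - 1" using deg6[OF w(1) m(2)] m(1) w(2) by simp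
    \<comment> \<open>One cell of larger defect makes the inequality strict; as 4 divides
      \<open>u\<close>, the bound \<open>u * (N - 1) / 4\<close> is an integer and drops by
      1.\<close>
    have "4 * int v * c < (\<Sum>x\<in>?X. N - 1)"
      unfolding total[symmetric] by (rule sum_strict_mono_ex1) (use le lt w in auto)
    then have "int v * (4 * c) < int v * (int u * (N - 1))" by (simp add: algebra_simps)
    then have "4 * c < int u * (N - 1)" using v by simp
    moreover have "4 dvd int u * (N - 1)"
    proof (rule dvd_mult2)
      show "4 dvd int u" using A(1) unfolding inA_def by presburger
    qed
    moreover have "c \<le> Q div 4 - 1" if "4 * c < Q" "4 dvd Q" for Q
      using that by presburger
    ultimately have "c \<le> (int u * (N - 1)) div 4 - 1" by blast
    moreover have "Jstar u v = (int u * (N - 1)) div 4 - 1"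
      using A unfolding Jstar_def Let_def floor_quarter N_def by (simp only: if_True if_False simp_thms)
    ultimately show ?thesis by (simp add: c_def)
  next
    case B
    have n: "n mod 12 = 0" using B(1) by (simp add: inB_def n_def)
    obtain w where w: "v = 6 * w" "w > 0" using B(1) v by (auto simp: inB_def)
    have m: "n mod 6 = 0" "even n" using n by presburger+
    have "int (deg x) \<le> N - 2" if "x \<in> ?X" for x
      using deg6[OF that m(2)] m(1) defect_ge_14[OF that] card_leave_sixth[OF w that] n cX by simp
    then have "c \<le> (int u * (N - 2)) div 4" by (rule bound)
    moreover have "Jstar u v = (int u * (N - 2)) div 4"
      using B unfolding Jstar_def Let_def floor_quarter N_def by (simp only: if_True if_False simp_thms)
    ultimately show ?thesis by (simp add: c_def)
  next
    case six
    have ev: "even n" using six(1) by presburger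
    have "int (deg x) \<le> N - 1" if "x \<in> ?X" for x
      using deg6[OF that ev] six(1) defect_ge_8[OF that] cX by simp
    then have "c \<le> (int u * (N - 1)) div 4" by (rule bound)
    moreover have "Jstar u v = (int u * (N - 1)) div 4"
      using six unfolding Jstar_def Let_def floor_quarter N_def n_def by (simp only: if_True if_False simp_thms)
    ultimately show ?thesis by (simp add: c_def)
  next
    case four
    have m: "even n" "4 dvd n" using four(1) by presburger+
    obtain h where h: "v = 2 * h" "h > 0" using four(2) v by auto
    have "int (deg x) \<le> N - 1" if "x \<in> ?X" for x
      using deg6[OF that m(1)] four(3) defect_ge_6_half[OF h that] m(2) cX by simp
    then have "c \<le> (int u * (N - 1)) div 4" by (rule bound)
    moreover have "Jstar u v = (int u * (N - 1)) div 4"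
      using four unfolding Jstar_def Let_def floor_quarter N_def n_def by (simp only: if_True if_False simp_thms)
    ultimately show ?thesis by (simp add: c_def)
  next
    case other
    have "int (deg x) \<le> N" if "x \<in> ?X" for x
    \<comment> \<open>For \<open>n = 1\<close> natural and integer \<open>n - 2\<close> differ, but
      the factor \<open>n - 1\<close> makes both products 0.\<close>
    proof (cases "n = 1")
      case True
      then show ?thesis using deg_le[OF that] cX by (simp add: N_def Nval_eq flip: n_def)
    next
      case False
      then have "int ((n - 1) * ((n - 2) div 2)) = (int n - 1) * ((int n - 2) div 2)"
        using n0 by (simp add: of_nat_diff zdiv_int)
      moreover have "int (3 * deg x) \<le> int ((n - 1) * ((n - 2) div 2))"
        using deg_le[OF that] unfolding cX of_nat_le_iff .
      ultimately have "3 * int (deg x) \<le> (int n - 1) * ((int n - 2) div 2)" by simp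
      then show ?thesis unfolding N_def Nval_eq n_def[symmetric] by linarith
    qed
    then have "c \<le> (int u * N) div 4" by (rule bound)
    moreover have "Jstar u v = (int u * N) div 4"
      using other unfolding Jstar_def Let_def floor_quarter N_def n_def by (simp only: if_True if_False simp_thms)
    ultimately show ?thesis by (simp add: c_def)
  qed
qed

theorem theorem5p7:
  fixes u v :: nat
  assumes "u > 0" and "v > 0"
  shows "int (Phi u v) \<le> Jstar u v"
proof -
  let ?S = "{card C | C. is_OOC u v C}"
  \<comment> \<open>\<open>Max\<close> is attained because the grid carries finitely many families
    of subsets and the empty code is admissible.\<close>
  have "?S \<subseteq> card ` Pow (Pow ({0..<u} \<times> {0..<v}))"
    by (auto simp: is_OOC_def is_matrix_def)
  then have "finite ?S" by (rule finite_subset) simp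
  moreover have "is_OOC u v {}" by (simp add: is_OOC_def)
  then have "?S \<noteq> {}" by blast
  ultimately have "Phi u v \<in> ?S" unfolding Phi_def by (rule Max_in)
  then show ?thesis using card_OOC_le_Jstar assms by auto
qed

end
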